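(* Let $A \in \mathbb{R}^{N\times N}$ be any symmetric positive-definite (SPD) matrix and let $\varepsilon \ge 0$. When the spaND algorithm using block diagonal scaling and orthogonal low-rank approximations (the variant OrthS) is applied to $A$ with tolerance $\varepsilon$, all the sparsified matrices it produces (that is, the trailing matrices obtained after the sparsification steps) remain SPD. In other words, the algorithm never breaks down: every diagonal block whose Cholesky factorization is required, in an elimination step or in a scaling step, is SPD.
   Context: **Ordering and clustering.** Let $G_A$ be the undirected graph with vertices $V=\{1,\dots,N\}$ and edges $\{(i,j): A_{ij}\neq 0\}$, and let $L\ge 1$ be a number of levels. A vertex-separator routine takes a vertex set and returns a partition $(\mathcal L,\mathcal M,\mathcal R)$ of it with no edge of $G_A$ between $\mathcal L$ and $\mathcal R$. Each vertex $v$ carries a label $C[v]=(C[v]_S,C[v]_L,C[v]_R)$, initially $((1,1),\text{none},\text{none})$. For $\ell=1,\dots,L-1$ and $k=1,\dots,2^{\ell-1}$: put $\mathcal I=\{v: C[v]_S=(\ell,k)\}$ and $\mathcal B=\{v: C[v]_L=(\ell,k)\text{ or }C[v]_R=(\ell,k)\}$; compute $(\mathcal L,\mathcal M,\mathcal R)=\text{vertex-separator}(\mathcal I\cup\mathcal B)$; set $C[v]_S$ to $(\ell,k)$ on $\mathcal M\setminus\mathcal B$, to $(\ell+1,2k-1)$ on $\mathcal L\setminus\mathcal B$, to $(\ell+1,2k)$ on $\mathcal R\setminus\mathcal B$; for $v\in\mathcal M\cap\mathcal I$ set $C[v]_L=(\ell+1,2k-1)$ and $C[v]_R=(\ell+1,2k)$;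 for $v\in\mathcal L\cap\mathcal B$ (resp. $v\in\mathcal R\cap\mathcal B$) replace $C[v]_L$ if it equals $(\ell,k)$, and otherwise $C[v]_R$, by $(\ell+1,2k-1)$ (resp. $(\ell+1,2k)$). Write $C^{(\ell)}$ for the labelling before step $\ell$ of the outer loop ($1 \le \ell\le L-1$) and $C^{(L)}$ for the final one. The separators at level $\ell$ are the sets of vertices with final $C[v]_S=(\ell,k)$ (for $\ell=L$ these are the leaf interiors). The clusters at level $\ell$ are the sets of vertices sharing the same label $C^{(\ell)}[v]$; clusters at level $\ell-1$ are unions of the clusters at level $\ell$ (restricted to vertices not yet eliminated). **spaND, variant OrthS.** The algorithm maintains a trailing matrix, initially $A$, indexed by the remaining degrees of freedom (dofs), each belonging to a cluster. For $\ell=L,L-1,\dots,1$ it performs the following steps. 1. *Elimination.* For each separator $s$ at level $\ell$ (its remaining dofs), with $n$ the remaining dofs coupled to $s$, compute the Cholesky factorization $A_{ss}=L_sL_s^\top$ of the current diagonal block, remove $s$, and replace $A_{nn}$ by the Schur complement $A_{nn}-A_{ns}A_{ss}^{-1}A_{sn}$. 2. *Scaling.* For each remaining cluster (called an interface) $p$ at level $\ell$, compute the Cholesky factorization $A_{pp}=L_pL_p^\top$, and replace $A_{pp}$ by $I$, $A_{pn}$ by $L_p^{-1}A_{pn}$ and $A_{np}$ by $A_{np}L_p^{-\top}$, where $n$ denotes all remaining dofs outside $p$ coupled to $p$. 3. *Sparsification.* For each interface $p$ in turn (so that $A_{pp}=I$), with $n$ all remaining dofs outside $p$ coupled to $p$,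 compute a decomposition $A_{pn}=Q_{pf}W_{fn}+Q_{pc}W_{cn}$ with $[\,Q_{pf}\ \ Q_{pc}\,]$ square orthogonal and $\|W_{fn}\|_2=\mathcal O(\varepsilon)$ (for example from a truncated rank-revealing QR factorization or a truncated SVD with tolerance $\varepsilon$). Change variables on $p$ by this orthogonal matrix, so that $p$ becomes $f\cup c$ with identity diagonal blocks, zero $f$–$c$ block, $f$–$n$ block $W_{fn}$ and $c$–$n$ block $W_{cn}$. Drop the blocks $W_{fn}$ and $W_{fn}^\top$, and remove the (now decoupled) dofs $f$; the dofs $c$ replace $p$, and $A_{nn}$ is unchanged. The resulting trailing matrix is a *sparsified matrix*. 4. *Merge.* Concatenate the dofs of the clusters at level $\ell$ that lie in the same cluster at level $\ell-1$. The algorithm *breaks down* if a Cholesky factorization required in step 1 or step 2 does not exist because the corresponding diagonal block is not SPD. All arithmetic is exact. *)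

theory Defs
  imports "Jordan_Normal_Form.DL_Submatrix" "Jordan_Normal_Form.Gauss_Jordan_Elimination"
begin

section \<open>Matrices\<close>

definition spd :: "real mat \<Rightarrow> bool" where
  "spd A \<longleftrightarrow> square_mat A \<and> A\<^sup>T = A \<and>
     (\<forall>x \<in> carrier_vec (dim_row A). x \<noteq> 0\<^sub>v (dim_row A) \<longrightarrow> 0 < x \<bullet> (A *\<^sub>v x))"

definition cholesky_factor :: "real mat \<Rightarrow> real mat \<Rightarrow> bool" where
  "cholesky_factor A F \<longleftrightarrow> F \<in> carrier_mat (dim_row A) (dim_row A) \<and>
     upper_triangular F\<^sup>T \<and> (\<forall>i < dim_row F. 0 < F $$ (i, i)) \<and> A = F * F\<^sup>T"

text \<open>The library's \<open>orthogonal_mat\<close> only asks for pairwise orthogonal nonzero columns; here the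
  columns must be orthonormal.\<close>

definition orthonormal_mat :: "real mat \<Rightarrow> bool" where
  "orthonormal_mat Q \<longleftrightarrow> square_mat Q \<and> inverts_mat Q\<^sup>T Q \<and> inverts_mat Q Q\<^sup>T"

text \<open>The spectral norm. The unit ball, rather than the unit sphere, makes it \<open>0\<close> for
  a matrix without columns.\<close>

definition norm2_mat :: "real mat \<Rightarrow> real" where
  "norm2_mat W =
     (SUP x \<in> {x \<in> carrier_vec (dim_col W). x \<bullet> x \<le> 1}. sqrt ((W *\<^sub>v x) \<bullet> (W *\<^sub>v x)))"

text \<open>\<open>minv A\<close> is meaningful for invertible \<open>A\<close> only.\<close>

definition minv :: "real mat \<Rightarrow> real mat" where
  "minv A = the (mat_inverse A)"

text \<open>\<open>set_block M I J B\<close> overwrites the block \<open>submatrix M I J\<close> by \<open>B\<close>. Rows and columns of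
  \<open>submatrix M I J\<close> are numbered by the increasing enumerations of \<open>I\<close> and \<open>J\<close>, so the
  entry \<open>(i, j)\<close> of \<open>M\<close> is found at the position given by the ranks of \<open>i\<close> in \<open>I\<close> and \<open>j\<close> in \<open>J\<close>.\<close>

definition set_block :: "real mat \<Rightarrow> nat set \<Rightarrow> nat set \<Rightarrow> real mat \<Rightarrow> real mat" where
  "set_block M I J B = mat (dim_row M) (dim_col M) (\<lambda>(i, j).
     if i \<in> I \<and> j \<in> J then B $$ (card {a \<in> I. a < i}, card {b \<in> J. b < j}) else M $$ (i, j))"

definition set_block_sym :: "real mat \<Rightarrow> nat set \<Rightarrow> nat set \<Rightarrow> real mat \<Rightarrow> real mat" where
  "set_block_sym M I J B = set_block (set_block M I J B) J I B\<^sup>T"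


section \<open>Ordering and clustering\<close>

text \<open>The vertices are \<open>0, \<dots>, N - 1\<close>. A separator routine maps a vertex set to a triple
  (left part, separator, right part); the parts may be empty.\<close>

type_synonym separator_routine = "nat set \<Rightarrow> nat set \<times> nat set \<times> nat set"

definition vertex_separator :: "real mat \<Rightarrow> separator_routine \<Rightarrow> bool" where
  "vertex_separator A vsep \<longleftrightarrow> (\<forall>U \<subseteq> {..<dim_row A}. case vsep U of (Lt, Md, Rt) \<Rightarrow>
     Lt \<union> Md \<union> Rt = U \<and> Lt \<inter> Md = {} \<and> Lt \<inter> Rt = {} \<and> Md \<inter> Rt = {} \<and>
     (\<forall>i \<in> Lt. \<forall>j \<in> Rt. A $$ (i, j) = 0 \<and> A $$ (j, i) = 0))"

datatype label =
  Label (lab_S: "nat \<times> nat") (lab_L: "(nat \<times> nat) option") (lab_R: "(nat \<times> nat) option")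

definition relabel ::
  "separator_routine \<Rightarrow> nat \<Rightarrow> nat \<Rightarrow> nat \<Rightarrow> (nat \<Rightarrow> label) \<Rightarrow> nat \<Rightarrow> label" where
  "relabel vsep N l k C =
    (let I = {v. v < N \<and> lab_S (C v) = (l, k)};
         B = {v. v < N \<and> (lab_L (C v) = Some (l, k) \<or> lab_R (C v) = Some (l, k))};
         (Lt, Md, Rt) = vsep (I \<union> B);
         left = (l + 1, 2 * k - 1);
         right = (l + 1, 2 * k)
     in (\<lambda>v.
       let S' = (if v \<in> Md - B then (l, k)
                 else if v \<in> Lt - B then left
                 else if v \<in> Rt - B then right
                 else lab_S (C v));
           subst = (\<lambda>new. if lab_L (C v) = Some (l, k)
                          then Label S' (Some new) (lab_R (C v))
                          else Label S' (lab_L (C v)) (Some new))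
       in if v \<in> Md \<inter> I then Label S' (Some left) (Some right)
          else if v \<in> Lt \<inter> B then subst left
          else if v \<in> Rt \<inter> B then subst right
          else Label S' (lab_L (C v)) (lab_R (C v))))"

text \<open>\<open>labelling vsep N l\<close> is \<open>C\<^sup>l\<close>, the labelling before step \<open>l\<close> of the outer loop, for
  \<open>l \<ge> 1\<close>; the value at \<open>0\<close> is a dummy. As the outer loop stops after step \<open>L - 1\<close>, the
  final labelling is \<open>labelling vsep N L\<close>.\<close>

fun labelling :: "separator_routine \<Rightarrow> nat \<Rightarrow> nat \<Rightarrow> nat \<Rightarrow> label" where
  "labelling vsep N 0 = (\<lambda>v. Label (1, 1) None None)"
| "labelling vsep N (Suc 0) = (\<lambda>v. Label (1, 1) None None)"
| "labelling vsep N (Suc (Suc m)) =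
     fold (relabel vsep N (Suc m)) [1 ..< 2 ^ m + 1] (labelling vsep N (Suc m))"

definition separators :: "separator_routine \<Rightarrow> nat \<Rightarrow> nat \<Rightarrow> nat \<Rightarrow> nat set set" where
  "separators vsep N L l =
     (\<lambda>k. {v. v < N \<and> lab_S (labelling vsep N L v) = (l, k)}) ` {1 .. 2 ^ (l - 1)}"

definition clusters_at :: "separator_routine \<Rightarrow> nat \<Rightarrow> nat \<Rightarrow> nat set set" where
  "clusters_at vsep N l =
     (\<lambda>u. {v. v < N \<and> labelling vsep N l v = labelling vsep N l u}) ` {..<N}"


section \<open>The algorithm\<close>

text \<open>A state consists of the current level, the current phase with the separators or interfaces
  still to be processed in it, the set \<open>R\<close> of remaining dofs, the set \<open>P\<close> of the current
  clusters of remaining dofs, and a matrix \<open>M\<close> of the size of the input, of which only the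
  trailing matrix \<open>submatrix M R R\<close> is relevant. The order in which the separators or
  interfaces of a level are processed is left open.

  Dofs are named by vertices. Since \<open>f\<close> and \<open>c\<close> together have as many dofs as
  \<open>p\<close>, the new dofs reuse the names in \<open>p\<close>; thus a dof is always named by a vertex of the
  cluster to which it belongs.\<close>

datatype phase =
  Eliminate "nat set set" | Scale "nat set set" | Sparsify "nat set set"

datatype spand_state =
  State (level: nat) (phase: phase) (dofs: "nat set") (clusters: "nat set set") (matrix: "real mat")

definition trailing :: "spand_state \<Rightarrow> real mat" where
  "trailing st = submatrix (matrix st) (dofs st) (dofs st)"

definition coupled :: "real mat \<Rightarrow> nat set \<Rightarrow> nat set \<Rightarrow> nat set" where
  "coupled M R p = {j \<in> R - p. \<exists>i \<in> p. M $$ (i, j) \<noteq> 0 \<or> M $$ (j, i) \<noteq> 0}"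

inductive eliminate_step :: "spand_state \<Rightarrow> spand_state \<Rightarrow> bool" where
  "eliminate_step (State l (Eliminate Ss) R P M)
     (State l (Eliminate (Ss - {t})) (R - s) ((\<lambda>p. p - s) ` P - {{}})
        (set_block M n n
          (submatrix M n n - submatrix M n s * minv (submatrix M s s) * submatrix M s n)))"
  if "t \<in> Ss" "s = t \<inter> R" "n = coupled M R s" "cholesky_factor (submatrix M s s) F"

inductive scale_step :: "spand_state \<Rightarrow> spand_state \<Rightarrow> bool" where
  "scale_step (State l (Scale Ps) R P M)
     (State l (Scale (Ps - {p})) R P
        (set_block (set_block (set_block M
           p p (1\<^sub>m (card p)))
           p n (minv F * submatrix M p n))
           n p (submatrix M n p * (minv F)\<^sup>T)))"
  if "p \<in> Ps" "n = coupled M R p" "cholesky_factor (submatrix M p p) F"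

text \<open>The bound \<open>d\<close> on the spectral norm of the dropped block is instantiated to \<open>K * \<epsilon>\<close> below,
  where \<open>K\<close> is the constant hidden in \<open>O(\<epsilon>)\<close>. The matrix \<open>(Qf\<^sup>T @\<^sub>r Qc\<^sup>T)\<^sup>T\<close>
  is \<open>Qf\<close> with \<open>Qc\<close> to its right.\<close>

inductive sparsify_step :: "real \<Rightarrow> spand_state \<Rightarrow> spand_state \<Rightarrow> bool" for d :: real where
  "sparsify_step d (State l (Sparsify Ps) R P M)
     (State l (Sparsify (Ps - {p})) (R - f) ((P - {p}) \<union> ({c} - {{}})) M'')"
  if "p \<in> Ps" "n = coupled M R p"
    "f \<union> c = p" "f \<inter> c = {}"
    "Qf \<in> carrier_mat (card p) (card f)" "Qc \<in> carrier_mat (card p) (card c)"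
    "orthonormal_mat (Qf\<^sup>T @\<^sub>r Qc\<^sup>T)\<^sup>T"
    "Wf \<in> carrier_mat (card f) (card n)" "Wc \<in> carrier_mat (card c) (card n)"
    "submatrix M p n = Qf * Wf + Qc * Wc"
    "norm2_mat Wf \<le> d"
    "M' = set_block_sym (set_block_sym (set_block M p p (1\<^sub>m (card p))) f n Wf) c n Wc"
    "M'' = set_block_sym M' f n (0\<^sub>m (card f) (card n))"

text \<open>As the dofs in \<open>p\<close> are named by vertices of \<open>p\<close>'s cluster, a cluster of dofs \<open>p\<close> lies in a
  coarser cluster of vertices \<open>q\<close> iff \<open>p \<subseteq> q\<close>.\<close>

definition merge :: "nat set set \<Rightarrow> nat set set \<Rightarrow> nat set set" where
  "merge Qs P = (\<lambda>q. \<Union> {p \<in> P. p \<subseteq> q}) ` Qs - {{}}"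

inductive next_phase :: "separator_routine \<Rightarrow> nat \<Rightarrow> nat \<Rightarrow> spand_state \<Rightarrow> spand_state \<Rightarrow> bool"
  for vsep :: separator_routine and N L :: nat where
  "next_phase vsep N L (State l (Eliminate {}) R P M) (State l (Scale P) R P M)"
| "next_phase vsep N L (State l (Scale {}) R P M) (State l (Sparsify P) R P M)"
| "next_phase vsep N L (State l (Sparsify {}) R P M)
     (State (l - 1) (Eliminate (separators vsep N L (l - 1))) R
        (merge (clusters_at vsep N (l - 1)) P) M)"
  if "1 < l"

inductive spand_reachable ::
  "separator_routine \<Rightarrow> nat \<Rightarrow> nat \<Rightarrow> real mat \<Rightarrow> real \<Rightarrow> spand_state \<Rightarrow> bool"
  for vsep :: separator_routine and N L :: nat and A :: "real mat" and d :: real where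
  "spand_reachable vsep N L A d
     (State L (Eliminate (separators vsep N L L)) {..<N} (clusters_at vsep N L) A)"
| "spand_reachable vsep N L A d st'"
  if "spand_reachable vsep N L A d st"
    "eliminate_step st st' \<or> scale_step st st' \<or> sparsify_step d st st' \<or> next_phase vsep N L st st'"

text \<open>The diagonal blocks one of which has to be factorized next.\<close>

fun cholesky_blocks :: "spand_state \<Rightarrow> real mat set" where
  "cholesky_blocks (State l (Eliminate Ss) R P M) = (\<lambda>t. submatrix M (t \<inter> R) (t \<inter> R)) ` Ss"
| "cholesky_blocks (State l (Scale Ps) R P M) = (\<lambda>p. submatrix M p p) ` Ps"
| "cholesky_blocks (State l (Sparsify Ps) R P M) = {}"

definition breaks_down :: "spand_state \<Rightarrow> bool" where
  "breaks_down st \<longleftrightarrow> (\<exists>D \<in> cholesky_blocks st. \<nexists>F. cholesky_factor D F)"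

end

theory Submission
  imports Defs "Jordan_Normal_Form.Determinant" "HOL-Library.Disjoint_Sets"
begin

text \<open>
  Each step turns a positive definite trailing matrix into a positive definite one. Elimination
  yields a Schur complement, and scaling is a congruence by an invertible block diagonal matrix.
  Once \<open>A\<^sub>p\<^sub>p = I\<close>, the orthogonal change of variables on \<open>p\<close> produces no \<open>f\<close>--\<open>c\<close> block, so
  dropping \<open>W\<^sub>f\<^sub>n\<close> and removing \<open>f\<close> leaves precisely the principal submatrix on
  \<open>c\<close> and the dofs outside \<open>p\<close> of an orthogonally congruent matrix, however large \<open>W\<^sub>f\<^sub>n\<close> is.
  That \<open>A\<^sub>p\<^sub>p = I\<close> still holds when \<open>p\<close> is reached follows from the disjointness of the clusters:
  processing one cluster does not touch the diagonal blocks of the others.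
\<close>

section \<open>Positive definite families\<close>

text \<open>Stated for a function on an arbitrary index set, so that passing to a principal block
  means shrinking \<open>I\<close>, and no renumbering of rows and columns enters the
  algebra.\<close>

definition posdef_on :: "(nat \<Rightarrow> nat \<Rightarrow> real) \<Rightarrow> nat set \<Rightarrow> bool" where
  "posdef_on f I \<longleftrightarrow> (\<forall>i\<in>I. \<forall>j\<in>I. f i j = f j i) \<and>
     (\<forall>x. (\<exists>i\<in>I. x i \<noteq> 0) \<longrightarrow> 0 < (\<Sum>i\<in>I. \<Sum>j\<in>I. x i * f i j * x j))"

lemma posdef_on_sym: "posdef_on f I \<Longrightarrow> i \<in> I \<Longrightarrow> j \<in> I \<Longrightarrow> f i j = f j i"
  by (simp add: posdef_on_def)

lemma posdef_on_pos:
  "posdef_on f I \<Longrightarrow> i \<in> I \<Longrightarrow> x i \<noteq> 0 \<Longrightarrow> 0 < (\<Sum>i\<in>I. \<Sum>j\<in>I. x i * f i j * x j)"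
  by (auto simp: posdef_on_def)

lemma posdef_on_cong:
  assumes "\<And>i j. i \<in> I \<Longrightarrow> j \<in> I \<Longrightarrow> f i j = g i j"
  shows "posdef_on f I \<longleftrightarrow> posdef_on g I"
  unfolding posdef_on_def using assms by (simp cong: sum.cong)

text \<open>Extending a vector on \<open>J\<close> by zero does not change the value of the
  form.\<close>

lemma posdef_on_subset:
  assumes "posdef_on f I" "J \<subseteq> I" "finite I"
  shows "posdef_on f J"
  unfolding posdef_on_def
proof (intro conjI allI impI)
  show "\<forall>i\<in>J. \<forall>j\<in>J. f i j = f j i"
    using assms by (meson posdef_on_sym subsetD)
  fix x :: "nat \<Rightarrow> real" assume "\<exists>i\<in>J. x i \<noteq> 0"
  then obtain i where i: "i \<in> J" "x i \<noteq> 0" by blast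
  define y where "y k = (if k \<in> J then x k else 0)" for k
  have "0 < (\<Sum>i\<in>I. \<Sum>j\<in>I. y i * f i j * y j)"
    using assms i by (intro posdef_on_pos[of _ _ i]) (auto simp: y_def)
  also have "\<dots> = (\<Sum>i\<in>I. \<Sum>j\<in>J. y i * f i j * y j)"
    using assms by (intro sum.cong refl sum.mono_neutral_right) (auto simp: y_def)
  also have "\<dots> = (\<Sum>i\<in>J. \<Sum>j\<in>J. y i * f i j * y j)"
    using assms by (intro sum.mono_neutral_right) (auto simp: y_def)
  also have "\<dots> = (\<Sum>i\<in>J. \<Sum>j\<in>J. x i * f i j * x j)"
    by (simp add: y_def)
  finally show "0 < (\<Sum>i\<in>J. \<Sum>j\<in>J. x i * f i j * x j)" .
qed

lemma posdef_on_reindex: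
  assumes "posdef_on f (h ` I)" "inj_on h I"
  shows "posdef_on (\<lambda>i j. f (h i) (h j)) I"
  unfolding posdef_on_def
proof (intro conjI allI impI)
  show "\<forall>i\<in>I. \<forall>j\<in>I. f (h i) (h j) = f (h j) (h i)"
    using assms by (auto simp: posdef_on_def)
  fix x :: "nat \<Rightarrow> real" assume "\<exists>i\<in>I. x i \<noteq> 0"
  then obtain i where i: "i \<in> I" "x i \<noteq> 0" by blast
  have "0 < (\<Sum>i\<in>h`I. \<Sum>j\<in>h`I. x (inv_into I h i) * f i j * x (inv_into I h j))"
    using assms i by (intro posdef_on_pos[of _ _ "h i"]) auto
  then show "0 < (\<Sum>i\<in>I. \<Sum>j\<in>I. x i * f (h i) (h j) * x j)"
    using assms(2) by (simp add: sum.reindex)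
qed

section \<open>Schur complements, congruences and the Cholesky factorization\<close>

lemma quadratic_form_Un:
  fixes x :: "nat \<Rightarrow> real"
  assumes "finite s" "finite r" "s \<inter> r = {}"
    and "\<And>i j. i \<in> s \<union> r \<Longrightarrow> j \<in> s \<union> r \<Longrightarrow> f i j = f j i"
  shows "(\<Sum>i\<in>s\<union>r. \<Sum>j\<in>s\<union>r. x i * f i j * x j) =
    (\<Sum>i\<in>s. \<Sum>j\<in>s. x i * f i j * x j) + 2 * (\<Sum>i\<in>s. \<Sum>j\<in>r. x i * f i j * x j) +
    (\<Sum>i\<in>r. \<Sum>j\<in>r. x i * f i j * x j)"
proof -
  have "(\<Sum>i\<in>r. \<Sum>j\<in>s. x i * f i j * x j) = (\<Sum>j\<in>s. \<Sum>i\<in>r. x j * f j i * x i)"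
    using assms(4) by (subst sum.swap) (auto intro!: sum.cong)
  then show ?thesis
    using assms(1-3) by (simp add: sum.union_disjoint sum.distrib)
qed

text \<open>The value of the Schur complement's form at \<open>x\<close> is the minimum of the form of \<open>f\<close> over
  the extensions of \<open>x\<close> to \<open>s\<close>; the minimizer is \<open>y = - b w\<close> with \<open>w = f\<^sub>s\<^sub>r x\<close>.\<close>

lemma posdef_on_schur:
  assumes fin: "finite s" "finite r" and disj: "s \<inter> r = {}"
    and f: "posdef_on f (s \<union> r)"
    and inv: "\<And>i j. i \<in> s \<Longrightarrow> j \<in> s \<Longrightarrow> (\<Sum>k\<in>s. f i k * b k j) = (if i = j then 1 else 0)"
    and b_sym: "\<And>i j. i \<in> s \<Longrightarrow> j \<in> s \<Longrightarrow> b i j = b j i"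
    and g: "\<And>i j. i \<in> r \<Longrightarrow> j \<in> r \<Longrightarrow> g i j = f i j - (\<Sum>k\<in>s. \<Sum>l\<in>s. f i k * b k l * f l j)"
  shows "posdef_on g r"
  unfolding posdef_on_def
proof (intro conjI allI impI ballI)
  have sym: "f i j = f j i" if "i \<in> s \<union> r" "j \<in> s \<union> r" for i j
    using posdef_on_sym[OF f that] .
  fix i j assume ij: "i \<in> r" "j \<in> r"
  have "(\<Sum>k\<in>s. \<Sum>l\<in>s. f i k * b k l * f l j) = (\<Sum>l\<in>s. \<Sum>k\<in>s. f i k * b k l * f l j)"
    by (rule sum.swap)
  also have "\<dots> = (\<Sum>l\<in>s. \<Sum>k\<in>s. f j l * b l k * f k i)"
    using ij by (intro sum.cong refl) (simp add: sym b_sym)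
  finally show "g i j = g j i" using g[OF ij] g[OF ij(2,1)] sym[of i j] ij by simp
next
  have sym: "f i j = f j i" if "i \<in> s \<union> r" "j \<in> s \<union> r" for i j
    using posdef_on_sym[OF f that] .
  fix x :: "nat \<Rightarrow> real" assume "\<exists>i\<in>r. x i \<noteq> 0"
  then obtain i0 where i0: "i0 \<in> r" "x i0 \<noteq> 0" by blast
  define w where "w k = (\<Sum>j\<in>r. f k j * x j)" for k
  define y where "y k = (if k \<in> r then x k else - (\<Sum>l\<in>s. b k l * w l))" for k
  have ys: "y k = - (\<Sum>l\<in>s. b k l * w l)" if "k \<in> s" for k
    using that disj by (auto simp: y_def)
  \<comment> \<open>This is stationarity in the \<open>s\<close> variables: the \<open>r\<close>
    variables contribute \<open>w i\<close>, so \<open>f\<close> applied to \<open>y\<close>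
    vanishes on \<open>s\<close>.\<close>
  have fy: "(\<Sum>k\<in>s. f i k * y k) = - w i" if "i \<in> s" for i
  proof -
    have "(\<Sum>k\<in>s. f i k * y k) = - (\<Sum>k\<in>s. \<Sum>l\<in>s. f i k * b k l * w l)"
      by (simp add: ys sum_distrib_left sum_negf mult.assoc)
    also have "(\<Sum>k\<in>s. \<Sum>l\<in>s. f i k * b k l * w l) = (\<Sum>l\<in>s. (\<Sum>k\<in>s. f i k * b k l) * w l)"
      by (subst sum.swap) (simp add: sum_distrib_right)
    also have "\<dots> = (\<Sum>l\<in>s. if i = l then w l else 0)"
      using that by (intro sum.cong refl) (simp add: inv)
    also have "\<dots> = w i" using that fin by simp
    finally show ?thesis .
  qed
  have "0 < (\<Sum>i\<in>s\<union>r. \<Sum>j\<in>s\<union>r. y i * f i j * y j)"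
    using i0 by (intro posdef_on_pos[OF f, of i0]) (auto simp: y_def)
  also have "\<dots> = (\<Sum>i\<in>s. \<Sum>j\<in>s. y i * f i j * y j) + 2 * (\<Sum>i\<in>s. \<Sum>j\<in>r. y i * f i j * y j) +
    (\<Sum>i\<in>r. \<Sum>j\<in>r. y i * f i j * y j)"
    using fin disj sym by (rule quadratic_form_Un)
  also have "(\<Sum>i\<in>s. \<Sum>j\<in>s. y i * f i j * y j) = (\<Sum>i\<in>s. y i * (\<Sum>j\<in>s. f i j * y j))"
    by (simp add: sum_distrib_left mult.assoc)
  also have "\<dots> = - (\<Sum>i\<in>s. y i * w i)"
    by (simp add: fy sum_negf)
  also have "(\<Sum>i\<in>s. \<Sum>j\<in>r. y i * f i j * y j) = (\<Sum>i\<in>s. y i * w i)"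
    by (simp add: w_def y_def sum_distrib_left mult.assoc)
  also have "(\<Sum>i\<in>r. \<Sum>j\<in>r. y i * f i j * y j) = (\<Sum>i\<in>r. \<Sum>j\<in>r. x i * f i j * x j)"
    by (simp add: y_def)
  finally have pos: "0 < (\<Sum>i\<in>s. y i * w i) + (\<Sum>i\<in>r. \<Sum>j\<in>r. x i * f i j * x j)" by simp
  \<comment> \<open>Moving the sums over \<open>r\<close> inside collects a factor \<open>w\<close>
    on each side of \<open>b\<close>; the resulting form of \<open>b\<close> at \<open>w\<close> is
    the negative of the pairing of \<open>y\<close> and \<open>w\<close> on \<open>s\<close>, by the
    choice of \<open>y\<close>.\<close>
  have "(\<Sum>i\<in>r. \<Sum>j\<in>r. x i * (\<Sum>k\<in>s. \<Sum>l\<in>s. f i k * b k l * f l j) * x j)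
     = (\<Sum>i\<in>r. \<Sum>j\<in>r. \<Sum>k\<in>s. \<Sum>l\<in>s. (f k i * x i) * b k l * (f l j * x j))"
    using sym by (auto simp: sum_distrib_left sum_distrib_right intro!: sum.cong)
  also have "\<dots> = (\<Sum>i\<in>r. \<Sum>k\<in>s. \<Sum>j\<in>r. \<Sum>l\<in>s. (f k i * x i) * b k l * (f l j * x j))"
    by (intro sum.cong refl sum.swap)
  also have "\<dots> = (\<Sum>k\<in>s. \<Sum>i\<in>r. \<Sum>l\<in>s. \<Sum>j\<in>r. (f k i * x i) * b k l * (f l j * x j))"
    by (subst sum.swap) (intro sum.cong refl sum.swap)
  also have "\<dots> = (\<Sum>k\<in>s. \<Sum>l\<in>s. \<Sum>i\<in>r. \<Sum>j\<in>r. (f k i * x i) * b k l * (f l j * x j))"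
    by (intro sum.cong refl sum.swap)
  also have "\<dots> = (\<Sum>k\<in>s. \<Sum>l\<in>s. w k * b k l * w l)"
    by (simp only: w_def sum_distrib_right) (simp only: sum_distrib_left)
  also have "\<dots> = - (\<Sum>i\<in>s. y i * w i)"
    by (simp add: ys sum_distrib_left sum_distrib_right mult_ac sum_negf)
  finally have corr: "(\<Sum>i\<in>r. \<Sum>j\<in>r. x i * (\<Sum>k\<in>s. \<Sum>l\<in>s. f i k * b k l * f l j) * x j)
     = - (\<Sum>i\<in>s. y i * w i)" .
  have "(\<Sum>i\<in>r. \<Sum>j\<in>r. x i * g i j * x j) =
     (\<Sum>i\<in>r. \<Sum>j\<in>r. x i * f i j * x j - x i * (\<Sum>k\<in>s. \<Sum>l\<in>s. f i k * b k l * f l j) * x j)"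
    by (intro sum.cong refl) (simp add: g right_diff_distrib left_diff_distrib)
  then show "0 < (\<Sum>i\<in>r. \<Sum>j\<in>r. x i * g i j * x j)"
    using pos corr by (simp add: sum_subtractf)
qed

text \<open>The matrix \<open>v\<close>, with right inverse \<open>u\<close>, may have fewer rows than columns: this covers both
  scaling (\<open>c = s\<close>) and sparsification (\<open>v = Q\<^sub>c\<^sup>T\<close>).\<close>

lemma posdef_on_congruence:
  assumes fin: "finite s" "finite r" "finite c" and disj: "s \<inter> r = {}" "c \<inter> r = {}"
    and f: "posdef_on f (s \<union> r)"
    and cc: "\<And>i j. i \<in> c \<Longrightarrow> j \<in> c \<Longrightarrow> g i j = (\<Sum>k\<in>s. \<Sum>l\<in>s. v i k * f k l * v j l)"
    and cr: "\<And>i j. i \<in> c \<Longrightarrow> j \<in> r \<Longrightarrow> g i j = (\<Sum>k\<in>s. v i k * f k j)"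
    and rc: "\<And>i j. i \<in> c \<Longrightarrow> j \<in> r \<Longrightarrow> g j i = g i j"
    and rr: "\<And>i j. i \<in> r \<Longrightarrow> j \<in> r \<Longrightarrow> g i j = f i j"
    and inv: "\<And>i j. i \<in> c \<Longrightarrow> j \<in> c \<Longrightarrow> (\<Sum>k\<in>s. v i k * u k j) = (if i = j then 1 else 0)"
  shows "posdef_on g (c \<union> r)"
proof -
  have fsym: "f i j = f j i" if "i \<in> s \<union> r" "j \<in> s \<union> r" for i j
    using posdef_on_sym[OF f that] .
  have gsym_cc: "g i j = g j i" if "i \<in> c" "j \<in> c" for i j
  proof -
    have "(\<Sum>k\<in>s. \<Sum>l\<in>s. v i k * f k l * v j l) = (\<Sum>l\<in>s. \<Sum>k\<in>s. v i k * f k l * v j l)"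
      by (rule sum.swap)
    also have "\<dots> = (\<Sum>l\<in>s. \<Sum>k\<in>s. v j l * f l k * v i k)"
      using fsym by (intro sum.cong refl) simp
    finally show ?thesis using cc that by simp
  qed
  have gsym: "g i j = g j i" if "i \<in> c \<union> r" "j \<in> c \<union> r" for i j
    using that gsym_cc rc rr fsym by (metis UnE UnI2)
  show ?thesis
    unfolding posdef_on_def
  proof (intro conjI allI impI ballI)
    fix x :: "nat \<Rightarrow> real" assume ex: "\<exists>i\<in>c\<union>r. x i \<noteq> 0"
    \<comment> \<open>On \<open>s\<close> this is the transpose of \<open>v\<close> applied to
      \<open>x\<close>; the form of \<open>f\<close> at \<open>y\<close> then equals the form of
      \<open>g\<close> at \<open>x\<close>.\<close>
    define y where "y k = (if k \<in> r then x k else \<Sum>i\<in>c. x i * v i k)" for k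
    have ys: "y k = (\<Sum>i\<in>c. x i * v i k)" if "k \<in> s" for k
      using that disj by (auto simp: y_def)
    have yr: "y k = x k" if "k \<in> r" for k using that by (simp add: y_def)
    \<comment> \<open>The right inverse \<open>u\<close> recovers \<open>x\<close> on
      \<open>c\<close> from \<open>y\<close> on \<open>s\<close>, so a nonzero \<open>x\<close>
      yields a nonzero \<open>y\<close>.\<close>
    have "x j = 0" if "j \<in> c" "\<forall>k\<in>s. y k = 0" for j
    proof -
      have "0 = (\<Sum>k\<in>s. y k * u k j)" using that by simp
      also have "\<dots> = (\<Sum>i\<in>c. x i * (\<Sum>k\<in>s. v i k * u k j))"
        unfolding sum_distrib_left by (subst sum.swap) (simp add: ys sum_distrib_right mult.assoc)
      also have "\<dots> = (\<Sum>i\<in>c. if i = j then x i else 0)"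
        using that by (intro sum.cong refl) (simp add: inv)
      finally show ?thesis using that fin by simp
    qed
    then obtain k0 where k0: "k0 \<in> s \<union> r" "y k0 \<noteq> 0" using ex yr by (metis UnE UnI1 UnI2)
    have "0 < (\<Sum>i\<in>s\<union>r. \<Sum>j\<in>s\<union>r. y i * f i j * y j)"
      using k0 by (intro posdef_on_pos[OF f, of k0])
    also have "\<dots> = (\<Sum>i\<in>s. \<Sum>j\<in>s. y i * f i j * y j) + 2 * (\<Sum>i\<in>s. \<Sum>j\<in>r. y i * f i j * y j) +
      (\<Sum>i\<in>r. \<Sum>j\<in>r. y i * f i j * y j)"
      using fin(1,2) disj(1) fsym by (rule quadratic_form_Un)
    also have "(\<Sum>i\<in>r. \<Sum>j\<in>r. y i * f i j * y j) = (\<Sum>i\<in>r. \<Sum>j\<in>r. x i * g i j * x j)"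
      by (simp add: yr rr)
    also have "(\<Sum>i\<in>s. \<Sum>j\<in>r. y i * f i j * y j) = (\<Sum>k\<in>s. \<Sum>j\<in>r. \<Sum>i\<in>c. x i * v i k * f k j * x j)"
      by (intro sum.cong refl) (simp add: yr ys sum_distrib_right)
    also have "\<dots> = (\<Sum>k\<in>s. \<Sum>i\<in>c. \<Sum>j\<in>r. x i * v i k * f k j * x j)"
      by (intro sum.cong refl sum.swap)
    also have "\<dots> = (\<Sum>i\<in>c. \<Sum>j\<in>r. \<Sum>k\<in>s. x i * v i k * f k j * x j)"
      by (subst sum.swap) (intro sum.cong refl sum.swap)
    also have "\<dots> = (\<Sum>i\<in>c. \<Sum>j\<in>r. x i * g i j * x j)"
      by (simp add: cr sum_distrib_left sum_distrib_right mult.assoc)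
    also have "(\<Sum>i\<in>s. \<Sum>j\<in>s. y i * f i j * y j) =
        (\<Sum>k\<in>s. \<Sum>l\<in>s. \<Sum>i\<in>c. \<Sum>j\<in>c. x i * v i k * f k l * (x j * v j l))"
      by (simp add: ys sum_distrib_right) (simp only: sum_distrib_left)
    also have "\<dots> = (\<Sum>k\<in>s. \<Sum>i\<in>c. \<Sum>l\<in>s. \<Sum>j\<in>c. x i * v i k * f k l * (x j * v j l))"
      by (intro sum.cong refl sum.swap)
    also have "\<dots> = (\<Sum>i\<in>c. \<Sum>k\<in>s. \<Sum>j\<in>c. \<Sum>l\<in>s. x i * v i k * f k l * (x j * v j l))"
      by (subst sum.swap) (intro sum.cong refl sum.swap)
    also have "\<dots> = (\<Sum>i\<in>c. \<Sum>j\<in>c. \<Sum>k\<in>s. \<Sum>l\<in>s. x i * v i k * f k l * (x j * v j l))"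
      by (intro sum.cong refl sum.swap)
    also have "\<dots> = (\<Sum>i\<in>c. \<Sum>j\<in>c. x i * g i j * x j)"
      by (simp add: cc sum_distrib_left sum_distrib_right mult_ac)
    also have "(\<Sum>i\<in>c. \<Sum>j\<in>c. x i * g i j * x j) + 2 * (\<Sum>i\<in>c. \<Sum>j\<in>r. x i * g i j * x j) +
        (\<Sum>i\<in>r. \<Sum>j\<in>r. x i * g i j * x j) = (\<Sum>i\<in>c\<union>r. \<Sum>j\<in>c\<union>r. x i * g i j * x j)"
      using fin(3,2) disj(2) gsym by (rule quadratic_form_Un[symmetric])
    finally show "0 < (\<Sum>i\<in>c\<union>r. \<Sum>j\<in>c\<union>r. x i * g i j * x j)" .
  qed (rule gsym)
qed

text \<open>Induction on \<open>n\<close>: eliminating index \<open>0\<close> leaves a Schur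
  complement, positive definite by \<open>posdef_on_schur\<close>, and its factor is bordered by the
  scaled first column of \<open>f\<close>.\<close>

lemma posdef_on_cholesky:
  assumes "posdef_on f {..<n}"
  shows "\<exists>g. (\<forall>i<n. 0 < g i i) \<and> (\<forall>i<n. \<forall>j<n. i < j \<longrightarrow> g i j = (0::real)) \<and>
    (\<forall>i<n. \<forall>j<n. f i j = (\<Sum>k<n. g i k * g j k))"
  using assms
proof (induction n arbitrary: f)
  case (Suc n)
  define a where "a = f 0 0"
  have "posdef_on f {0}" using posdef_on_subset[OF Suc.prems, of "{0}"] by simp
  from posdef_on_pos[OF this, of 0 "\<lambda>_. 1"] have a: "0 < a" by (simp add: a_def)
  define f' where "f' i j = f i j - f i 0 * (1 / a) * f 0 j" for i j
  have eq: "{..<Suc n} = {0} \<union> Suc ` {..<n}" by (auto simp: lessThan_Suc_eq_insert_0)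
  \<comment> \<open>The eliminated block is the single pivot \<open>a\<close>, whose inverse is
    \<open>1 / a\<close>.\<close>
  have "posdef_on f' (Suc ` {..<n})"
    using a Suc.prems unfolding eq
    by (intro posdef_on_schur[of "{0}" "Suc ` {..<n}" f "\<lambda>_ _. 1 / a"]) (auto simp: f'_def a_def)
  then have "posdef_on (\<lambda>i j. f' (Suc i) (Suc j)) {..<n}"
    by (rule posdef_on_reindex) simp
  from Suc.IH[OF this] obtain g where g: "\<forall>i<n. 0 < g i i"
      "\<forall>i<n. \<forall>j<n. i < j \<longrightarrow> g i j = 0"
      "\<forall>i<n. \<forall>j<n. f' (Suc i) (Suc j) = (\<Sum>k<n. g i k * g j k)"
    by blast
  \<comment> \<open>Column \<open>0\<close> is the first column of \<open>f\<close> over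
    \<open>sqrt a\<close>, row \<open>0\<close> is zero after its first entry, and the factor
    \<open>g\<close> of the complement sits one place down and to the right.\<close>
  define h where "h i j = (case j of 0 \<Rightarrow> f i 0 / sqrt a | Suc j' \<Rightarrow> (case i of 0 \<Rightarrow> 0 | Suc i' \<Rightarrow> g i' j'))" for i j
  have "f i j = (\<Sum>k<Suc n. h i k * h j k)" if ij: "i < Suc n" "j < Suc n" for i j
  proof -
    have "f j 0 = f 0 j" using posdef_on_sym[OF Suc.prems] ij by simp
    then have h0: "h i 0 * h j 0 = f i 0 * (1 / a) * f 0 j" using a by (simp add: h_def)
    have "(\<Sum>k<Suc n. h i k * h j k) = h i 0 * h j 0 + (\<Sum>k<n. h i (Suc k) * h j (Suc k))"
      by (rule sum.lessThan_Suc_shift)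
    also have "\<dots> = f i j"
    proof (cases i)
      case 0
      then show ?thesis using a unfolding h0 by (simp add: a_def) (simp add: h_def)
    next
      case (Suc i')
      show ?thesis
      proof (cases j)
        case 0
        then show ?thesis using a unfolding h0 by (simp add: a_def) (simp add: h_def)
      next
        case (Suc j')
        have "f' (Suc i') (Suc j') = (\<Sum>k<n. g i' k * g j' k)"
          using g(3) ij Suc \<open>i = Suc i'\<close> by simp
        then show ?thesis using Suc \<open>i = Suc i'\<close> unfolding h0 by (simp add: h_def f'_def)
      qed
    qed
    finally show ?thesis by simp
  qed
  moreover have "0 < h i i" if "i < Suc n" for i
    using that a g(1) by (cases i) (auto simp: h_def a_def)
  moreover have "h i j = 0" if "i < Suc n" "j < Suc n" "i < j" for i j
    using that g(2) by (auto simp: h_def split: nat.split)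
  ultimately show ?case by blast
qed auto

section \<open>Blocks of matrices\<close>

text \<open>The inverse of \<open>pick I\<close> on \<open>I\<close>: it converts a global index
  into a position within a block, exactly as \<open>set_block\<close> does.\<close>

abbreviation rank :: "nat set \<Rightarrow> nat \<Rightarrow> nat" where
  "rank I i \<equiv> card {a \<in> I. a < i}"

lemma bij_betw_pick: "finite I \<Longrightarrow> bij_betw (pick I) {..<card I} I"
  by (rule bij_betw_byWitness[where f' = "rank I"])
    (auto simp: pick_card_in_set card_pick_le pick_in_set_le intro!: psubset_card_mono)

lemma bij_betw_rank: "finite I \<Longrightarrow> bij_betw (rank I) I {..<card I}"
  by (rule bij_betw_byWitness[where f' = "pick I"])
    (auto simp: pick_card_in_set card_pick_le pick_in_set_le intro!: psubset_card_mono)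

lemma rank_less: "finite I \<Longrightarrow> i \<in> I \<Longrightarrow> rank I i < card I"
  using bij_betw_rank bij_betwE by blast

lemma rank_eq_iff: "finite I \<Longrightarrow> i \<in> I \<Longrightarrow> j \<in> I \<Longrightarrow> rank I i = rank I j \<longleftrightarrow> i = j"
  by (metis pick_card_in_set)

text \<open>Rewrites a product of blocks as a sum over global indices, the form in which the lemmas
  on \<open>posdef_on\<close> expect it.\<close>

lemma mult_index_rank:
  assumes "A \<in> carrier_mat (card I) (card K)" "B \<in> carrier_mat (card K) (card J)"
    and "finite I" "finite J" "finite K" "i \<in> I" "j \<in> J"
  shows "(A * B) $$ (rank I i, rank J j) =
    (\<Sum>k\<in>K. A $$ (rank I i, rank K k) * B $$ (rank K k, rank J j))"
proof -
  have "(A * B) $$ (rank I i, rank J j) = (\<Sum>k<card K. A $$ (rank I i, k) * B $$ (k, rank J j))"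
    using assms rank_less[of I i] rank_less[of J j]
    by (simp add: scalar_prod_def atLeast0LessThan)
  also have "\<dots> = (\<Sum>k\<in>K. A $$ (rank I i, rank K k) * B $$ (rank K k, rank J j))"
    by (rule sum.reindex_bij_betw[OF bij_betw_rank[OF \<open>finite K\<close>], symmetric])
  finally show ?thesis .
qed

lemma submatrix_carrier:
  assumes "M \<in> carrier_mat N N" "I \<subseteq> {..<N}" "J \<subseteq> {..<N}"
  shows "submatrix M I J \<in> carrier_mat (card I) (card J)"
proof -
  have "{i. i < N \<and> i \<in> I} = I" "{j. j < N \<and> j \<in> J} = J" using assms by auto
  then show ?thesis using assms by (intro carrier_matI) (simp_all add: dim_submatrix)
qed

lemma submatrix_index_rank:
  assumes "M \<in> carrier_mat N N" "I \<subseteq> {..<N}" "J \<subseteq> {..<N}" "i \<in> I" "j \<in> J"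
  shows "submatrix M I J $$ (rank I i, rank J j) = M $$ (i, j)"
  using assms by (intro submatrix_index_card) auto

lemma set_block_carrier [simp]:
  "M \<in> carrier_mat m n \<Longrightarrow> set_block M I J B \<in> carrier_mat m n"
  by (rule carrier_matI) (simp_all add: set_block_def)

lemma set_block_index:
  assumes "M \<in> carrier_mat N N" "i < N" "j < N"
  shows "set_block M I J B $$ (i, j) =
    (if i \<in> I \<and> j \<in> J then B $$ (rank I i, rank J j) else M $$ (i, j))"
  using assms by (simp add: set_block_def)

section \<open>Positive definite matrices, inverses and orthonormal columns\<close>

lemma spd_iff_posdef_on:
  assumes "A \<in> carrier_mat n n"
  shows "spd A \<longleftrightarrow> posdef_on (\<lambda>i j. A $$ (i, j)) {..<n}"
proof -
  have form: "v \<bullet> (A *\<^sub>v v) = (\<Sum>i<n. \<Sum>j<n. v $ i * A $$ (i, j) * v $ j)"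
    if "v \<in> carrier_vec n" for v
    using that assms by (simp add: scalar_prod_def atLeast0LessThan sum_distrib_left mult.assoc)
  have sym: "A\<^sup>T = A \<longleftrightarrow> (\<forall>i\<in>{..<n}. \<forall>j\<in>{..<n}. A $$ (i, j) = A $$ (j, i))"
  proof
    assume "A\<^sup>T = A"
    then show "\<forall>i\<in>{..<n}. \<forall>j\<in>{..<n}. A $$ (i, j) = A $$ (j, i)"
      using assms by (metis carrier_matD index_transpose_mat(1) lessThan_iff)
  qed (use assms in \<open>auto intro!: eq_matI\<close>)
  have "(\<forall>v\<in>carrier_vec n. v \<noteq> 0\<^sub>v n \<longrightarrow> 0 < v \<bullet> (A *\<^sub>v v)) \<longleftrightarrow>
    (\<forall>x. (\<exists>i\<in>{..<n}. x i \<noteq> 0) \<longrightarrow> 0 < (\<Sum>i<n. \<Sum>j<n. x i * A $$ (i, j) * x j))"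
    (is "?L \<longleftrightarrow> ?R")
  proof
    assume L: ?L
    show ?R
    proof (intro allI impI)
      fix x :: "nat \<Rightarrow> real" assume "\<exists>i\<in>{..<n}. x i \<noteq> 0"
      then have "vec n x \<noteq> 0\<^sub>v n" by (metis index_vec index_zero_vec(1) lessThan_iff)
      with L have "0 < vec n x \<bullet> (A *\<^sub>v vec n x)" by simp
      then show "0 < (\<Sum>i<n. \<Sum>j<n. x i * A $$ (i, j) * x j)" by (simp add: form)
    qed
  next
    assume R: ?R
    show ?L
    proof (intro ballI impI)
      fix v :: "real vec" assume v: "v \<in> carrier_vec n" "v \<noteq> 0\<^sub>v n"
      then have "\<exists>i\<in>{..<n}. v $ i \<noteq> 0" by (auto intro: eq_vecI)
      with R v show "0 < v \<bullet> (A *\<^sub>v v)" by (simp add: form)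
    qed
  qed
  then show ?thesis using assms sym by (auto simp: spd_def posdef_on_def)
qed

text \<open>Since \<open>pick I\<close> enumerates \<open>I\<close> injectively, the block is a
  reindexing of the family on \<open>I\<close>.\<close>

lemma spd_submatrix:
  assumes M: "M \<in> carrier_mat N N" and I: "I \<subseteq> {..<N}" and pd: "posdef_on (\<lambda>i j. M $$ (i, j)) I"
  shows "spd (submatrix M I I)"
proof -
  have bij: "bij_betw (pick I) {..<card I} I"
    using I by (intro bij_betw_pick) (auto intro: finite_subset)
  have "posdef_on (\<lambda>i j. M $$ (pick I i, pick I j)) {..<card I}"
    using posdef_on_reindex[of "\<lambda>i j. M $$ (i, j)" "pick I" "{..<card I}"] bij pd
    by (simp add: bij_betw_def)
  moreover have "submatrix M I I $$ (i, j) = M $$ (pick I i, pick I j)"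
    if "i < card I" "j < card I" for i j
    using that submatrix_carrier[OF M I I]
    by (intro submatrix_index) (simp_all flip: dim_submatrix[of M I I])
  ultimately have "posdef_on (\<lambda>i j. submatrix M I I $$ (i, j)) {..<card I}"
    by (subst posdef_on_cong[where g = "\<lambda>i j. M $$ (pick I i, pick I j)"]) auto
  then show ?thesis
    by (simp add: spd_iff_posdef_on[OF submatrix_carrier[OF M I I]])
qed

lemma spd_imp_cholesky_factor:
  assumes "spd A"
  shows "\<exists>F. cholesky_factor A F"
proof -
  define n where "n = dim_row A"
  have A: "A \<in> carrier_mat n n" using assms by (auto simp: spd_def n_def)
  with assms have "posdef_on (\<lambda>i j. A $$ (i, j)) {..<n}" by (simp add: spd_iff_posdef_on)
  then obtain g where g: "\<forall>i<n. 0 < g i i" "\<forall>i<n. \<forall>j<n. i < j \<longrightarrow> g i j = (0::real)"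
    "\<forall>i<n. \<forall>j<n. A $$ (i, j) = (\<Sum>k<n. g i k * g j k)"
    using posdef_on_cholesky by blast
  define F where "F = mat n n (\<lambda>(i, j). g i j)"
  have "upper_triangular F\<^sup>T" using g(2) by (intro upper_triangularI) (simp add: F_def)
  moreover have "\<forall>i<n. 0 < F $$ (i, i)" using g(1) by (simp add: F_def)
  moreover have "A = F * F\<^sup>T"
    using A g(3) by (intro eq_matI) (auto simp: F_def scalar_prod_def atLeast0LessThan)
  moreover have "F \<in> carrier_mat n n" by (simp add: F_def)
  ultimately have "cholesky_factor A F"
    unfolding cholesky_factor_def n_def[symmetric] by auto
  then show ?thesis by blast
qed

text \<open>A nonzero determinant makes \<open>A\<close> a unit of the matrix ring, so
  \<open>mat_inverse\<close> returns \<open>Some\<close> and the unspecified value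
  \<open>the None\<close> cannot occur.\<close>

lemma minv:
  assumes "A \<in> carrier_mat n n" "det A \<noteq> 0"
  shows "minv A \<in> carrier_mat n n" "A * minv A = 1\<^sub>m n" "minv A * A = 1\<^sub>m n"
proof -
  have "A \<in> Units (ring_mat TYPE(real) n ())"
    using assms by (rule det_non_zero_imp_unit)
  then obtain B where "mat_inverse A = Some B"
    using mat_inverse(1)[OF assms(1), where b = "()"] by (cases "mat_inverse A") auto
  with mat_inverse(2)[OF assms(1), of B]
  show "minv A \<in> carrier_mat n n" "A * minv A = 1\<^sub>m n" "minv A * A = 1\<^sub>m n"
    by (auto simp: minv_def)
qed

lemma cholesky_factor_carrier:
  "cholesky_factor A F \<Longrightarrow> A \<in> carrier_mat n n \<Longrightarrow> F \<in> carrier_mat n n"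
  by (simp add: cholesky_factor_def)

text \<open>The determinant of a triangular matrix is the product of its diagonal, which is positive
  here. Hence \<open>minv\<close> yields genuine inverses of \<open>A\<close> and
  \<open>F\<close>.\<close>

lemma cholesky_factor_det:
  assumes "cholesky_factor A F" "A \<in> carrier_mat n n"
  shows "det F \<noteq> 0" "det A \<noteq> 0"
proof -
  have F: "F \<in> carrier_mat n n" using assms by (rule cholesky_factor_carrier)
  have "det F\<^sup>T = prod_list (diag_mat F\<^sup>T)"
    using assms F by (intro det_upper_triangular[of _ n]) (auto simp: cholesky_factor_def)
  moreover have "0 \<notin> set (diag_mat F\<^sup>T)"
    using assms F by (force simp: cholesky_factor_def diag_mat_def)
  ultimately show "det F \<noteq> 0" using F by (simp add: det_transpose prod_list_zero_iff)
  then show "det A \<noteq> 0"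
    using assms F by (simp add: cholesky_factor_def det_mult[of _ n] det_transpose)
qed

text \<open>The rows of \<open>X\<close> are the columns of \<open>Qf\<close> followed by those of
  \<open>Qc\<close>, so both identities are blocks of
  \<open>X * X\<^sup>T = 1\<^sub>m (k + l)\<close>.\<close>

lemma orthonormal_append:
  assumes Qf: "Qf \<in> carrier_mat m k" and Qc: "Qc \<in> carrier_mat m l"
    and Q: "orthonormal_mat (Qf\<^sup>T @\<^sub>r Qc\<^sup>T)\<^sup>T"
  shows "Qc\<^sup>T * Qf = 0\<^sub>m l k" "Qc\<^sup>T * Qc = 1\<^sub>m l"
proof -
  define X where "X = Qf\<^sup>T @\<^sub>r Qc\<^sup>T"
  have X: "X \<in> carrier_mat (k + l) m"
    using Qf Qc unfolding X_def by (intro carrier_append_rows) auto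
  have XX: "X * X\<^sup>T = 1\<^sub>m (k + l)"
    using Q X unfolding orthonormal_mat_def inverts_mat_def X_def[symmetric] by simp
  have rows: "row X i = col Qf i" if "i < k" for i
    using that Qf Qc by (intro eq_vecI) (auto simp: X_def append_rows_def)
  have rows': "row X (k + i) = col Qc i" if "i < l" for i
    using that Qf Qc by (intro eq_vecI) (auto simp: X_def append_rows_def)
  have dot: "row X i \<bullet> row X j = (if i = j then 1 else 0)" if "i < k + l" "j < k + l" for i j
    using arg_cong[OF XX, of "\<lambda>B. B $$ (i, j)"] that X by simp
  show "Qc\<^sup>T * Qf = 0\<^sub>m l k"
  proof (rule eq_matI)
    fix i j assume "i < dim_row (0\<^sub>m l k)" "j < dim_col (0\<^sub>m l k)"
    then show "(Qc\<^sup>T * Qf) $$ (i, j) = 0\<^sub>m l k $$ (i, j)"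
      using dot[of "k + i" j] Qf Qc by (simp add: rows rows')
  qed (use Qf Qc in auto)
  show "Qc\<^sup>T * Qc = 1\<^sub>m l"
  proof (rule eq_matI)
    fix i j assume "i < dim_row (1\<^sub>m l)" "j < dim_col (1\<^sub>m l)"
    then show "(Qc\<^sup>T * Qc) $$ (i, j) = 1\<^sub>m l $$ (i, j)"
      using dot[of "k + i" "k + j"] Qc by (simp add: rows')
  qed (use Qc in auto)
qed

section \<open>The steps of the algorithm\<close>

abbreviation posdef_block :: "real mat \<Rightarrow> nat set \<Rightarrow> bool" where
  "posdef_block M \<equiv> posdef_on (\<lambda>i j. M $$ (i, j))"

text \<open>The identity diagonal block, in global indices: scaling establishes it and
  sparsification relies on it.\<close>

definition one_block :: "real mat \<Rightarrow> nat set \<Rightarrow> bool" where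
  "one_block M p \<longleftrightarrow> (\<forall>i\<in>p. \<forall>j\<in>p. M $$ (i, j) = (if i = j then 1 else 0))"

lemma coupled_subset: "coupled M R p \<subseteq> R - p"
  by (auto simp: coupled_def)

text \<open>The algorithm updates only coupled blocks; as the other blocks vanish, its formulas may
  be read over all of \<open>R - p\<close>.\<close>

lemma not_coupledD:
  "j \<in> R - p \<Longrightarrow> j \<notin> coupled M R p \<Longrightarrow> i \<in> p \<Longrightarrow> M $$ (i, j) = 0 \<and> M $$ (j, i) = 0"
  by (auto simp: coupled_def)

text \<open>Transposing \<open>A * B = 1\<^sub>m n\<close> makes \<open>B\<^sup>T\<close> a left
  inverse of \<open>A\<close>, and a left inverse equals a right inverse.\<close>

lemma inverse_mat_sym:
  fixes A :: "real mat"
  assumes A: "A \<in> carrier_mat n n" "A\<^sup>T = A" and B: "B \<in> carrier_mat n n" and AB: "A * B = 1\<^sub>m n"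
  shows "B\<^sup>T = B"
proof -
  have "B\<^sup>T * A = (A * B)\<^sup>T" using A B by (simp add: transpose_mult[of _ n n])
  also have "\<dots> = 1\<^sub>m n" by (simp add: AB)
  finally have BA: "B\<^sup>T * A = 1\<^sub>m n" .
  have "B\<^sup>T = B\<^sup>T * (A * B)" using B by (simp add: AB)
  also have "\<dots> = B\<^sup>T * A * B" using A B by (simp add: assoc_mult_mat[of _ n n _ n])
  also have "\<dots> = B" using B by (simp add: BA)
  finally show ?thesis .
qed

text \<open>The update on \<open>n\<close> alone already gives the Schur complement on all of
  \<open>R - s\<close>, so \<open>posdef_on_schur\<close> applies with \<open>b\<close> the inverse
  of the pivot block in global indices.\<close>

lemma eliminate_posdef:
  assumes M: "M \<in> carrier_mat N N" and R: "R \<subseteq> {..<N}" and pd: "posdef_block M R"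
    and s: "s \<subseteq> R" and n: "n = coupled M R s" and F: "cholesky_factor (submatrix M s s) F"
  shows "posdef_block (set_block M n n
    (submatrix M n n - submatrix M n s * minv (submatrix M s s) * submatrix M s n)) (R - s)"
    (is "posdef_block ?M' _")
proof -
  define B where "B = minv (submatrix M s s)"
  have nR: "n \<subseteq> R - s" using coupled_subset n by simp
  have fin: "finite R" "finite s" "finite n"
    using R s nR by (auto intro: finite_subset)
  have sN: "s \<subseteq> {..<N}" and nN: "n \<subseteq> {..<N}" using R s nR by auto
  note sub = submatrix_carrier[OF M]
  note idx = submatrix_index_rank[OF M]
  have Ms: "submatrix M s s \<in> carrier_mat (card s) (card s)" using sN by (intro sub)
  note B = minv[OF Ms cholesky_factor_det(2)[OF F Ms], folded B_def]
  have "posdef_block M s" using pd s fin(1) by (rule posdef_on_subset)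
  with M sN have "spd (submatrix M s s)" by (rule spd_submatrix)
  then have "(submatrix M s s)\<^sup>T = submatrix M s s" by (simp add: spd_def)
  from inverse_mat_sym[OF Ms this B(1,2)] have BT: "B\<^sup>T = B" .
  define b where "b i j = B $$ (rank s i, rank s j)" for i j
  have b_sym: "b i j = b j i" if "i \<in> s" "j \<in> s" for i j
    using that B(1) rank_less[OF fin(2)] arg_cong[OF BT, of "\<lambda>B. B $$ (rank s i, rank s j)"]
    by (simp add: b_def)
  have b_inv: "(\<Sum>k\<in>s. M $$ (i, k) * b k j) = (if i = j then 1 else 0)" if "i \<in> s" "j \<in> s" for i j
  proof -
    have "(\<Sum>k\<in>s. M $$ (i, k) * b k j) = (submatrix M s s * B) $$ (rank s i, rank s j)"
      using that sN by (simp add: mult_index_rank[OF Ms B(1) fin(2) fin(2) fin(2)] idx b_def)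
    also have "\<dots> = (if i = j then 1 else 0)"
      using that rank_less[OF fin(2)] by (simp add: B(2) rank_eq_iff[OF fin(2)])
    finally show ?thesis .
  qed
  have entry: "?M' $$ (i, j) = M $$ (i, j) - (\<Sum>k\<in>s. \<Sum>l\<in>s. M $$ (i, k) * b k l * M $$ (l, j))"
    if ij: "i \<in> R - s" "j \<in> R - s" for i j
  proof -
    have ijN: "i < N" "j < N" using ij R by auto
    show ?thesis
    proof (cases "i \<in> n \<and> j \<in> n")
      case True
      have Mns: "submatrix M n s \<in> carrier_mat (card n) (card s)"
        and Msn: "submatrix M s n \<in> carrier_mat (card s) (card n)"
        using sN nN by (auto intro: sub)
      have "(submatrix M n s * B * submatrix M s n) $$ (rank n i, rank n j) =
          (\<Sum>k\<in>s. M $$ (i, k) * (\<Sum>l\<in>s. b k l * M $$ (l, j)))"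
        using True Mns Msn B(1) sN nN fin
        by (simp add: mult_index_rank[of _ n s _ n] mult_index_rank[of _ s s _ n] idx b_def)
      also have "\<dots> = (\<Sum>k\<in>s. \<Sum>l\<in>s. M $$ (i, k) * b k l * M $$ (l, j))"
        by (simp add: sum_distrib_left mult.assoc)
      finally show ?thesis
        using True Mns Msn B(1) sN nN rank_less[OF fin(3)] ijN
        by (simp add: set_block_index[OF M] idx flip: B_def)
    next
      case False
      \<comment> \<open>If \<open>i\<close> or \<open>j\<close> is not coupled to \<open>s\<close>,
        one outer factor vanishes; the Schur correction is zero, in agreement with the untouched
        entry.\<close>
      then have "M $$ (i, k) * b k l * M $$ (l, j) = 0" if "k \<in> s" "l \<in> s" for k l
        using that ij not_coupledD[of _ R s M] n by (metis mult_zero_left mult_zero_right)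
      then have "(\<Sum>k\<in>s. \<Sum>l\<in>s. M $$ (i, k) * b k l * M $$ (l, j)) = 0"
        by (intro sum.neutral ballI)
      then show ?thesis using False ijN by (auto simp: set_block_index[OF M])
    qed
  qed
  have "s \<union> (R - s) = R" using s by auto
  with pd show ?thesis
    using fin by (intro posdef_on_schur[of s "R - s" "\<lambda>i j. M $$ (i, j)" b]) (auto simp: b_inv entry intro: b_sym)
qed

text \<open>This is \<open>posdef_on_congruence\<close> with \<open>c = s = p\<close>, where
  \<open>v\<close> is the inverse of the Cholesky factor and \<open>u\<close> the factor itself. The
  last conclusion protects the identity blocks of the other clusters.\<close>

lemma scale_posdef:
  assumes M: "M \<in> carrier_mat N N" and R: "R \<subseteq> {..<N}" and pd: "posdef_block M R"
    and p: "p \<subseteq> R" and n: "n = coupled M R p" and F: "cholesky_factor (submatrix M p p) F"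
    and M': "M' = set_block (set_block (set_block M
           p p (1\<^sub>m (card p)))
           p n (minv F * submatrix M p n))
           n p (submatrix M n p * (minv F)\<^sup>T)"
  shows "posdef_block M' R" "one_block M' p"
    "\<And>i j. i \<in> R - p \<Longrightarrow> j \<in> R - p \<Longrightarrow> M' $$ (i, j) = M $$ (i, j)"
proof -
  define G where "G = minv F"
  have nR: "n \<subseteq> R - p" using coupled_subset n by simp
  have fin: "finite R" "finite p" "finite n"
    using R p nR by (auto intro: finite_subset)
  have pN: "p \<subseteq> {..<N}" and nN: "n \<subseteq> {..<N}" using R p nR by auto
  note sub = submatrix_carrier[OF M]
  note idx = submatrix_index_rank[OF M]
  note rl = rank_less[OF fin(2)] rank_less[OF fin(3)]
  have Mp: "submatrix M p p \<in> carrier_mat (card p) (card p)"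
    and Mpn: "submatrix M p n \<in> carrier_mat (card p) (card n)"
    and Mnp: "submatrix M n p \<in> carrier_mat (card n) (card p)"
    using pN nN by (auto intro: sub)
  have Fc: "F \<in> carrier_mat (card p) (card p)" using F Mp by (rule cholesky_factor_carrier)
  note G = minv[OF Fc cholesky_factor_det(1)[OF F Mp], folded G_def]
  have eq: "submatrix M p p = F * F\<^sup>T" using F by (simp add: cholesky_factor_def)
  \<comment> \<open>The identity written into the diagonal block is thus what the congruence by
    \<open>G\<close> produces there.\<close>
  have "G * (submatrix M p p * G\<^sup>T) = (G * F) * (F\<^sup>T * G\<^sup>T)"
    unfolding eq using G(1) Fc by (simp add: assoc_mult_mat[of _ "card p" "card p" _ "card p" _ "card p"])
  also have "F\<^sup>T * G\<^sup>T = (G * F)\<^sup>T" using G(1) Fc by (simp add: transpose_mult[of _ "card p" "card p"])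
  finally have GMG: "G * (submatrix M p p * G\<^sup>T) = 1\<^sub>m (card p)" by (simp add: G(3))
  define v where "v i k = G $$ (rank p i, rank p k)" for i k
  define u where "u i k = F $$ (rank p i, rank p k)" for i k
  have vu: "(\<Sum>k\<in>p. v i k * u k j) = (if i = j then 1 else 0)" if "i \<in> p" "j \<in> p" for i j
  proof -
    have "(\<Sum>k\<in>p. v i k * u k j) = (G * F) $$ (rank p i, rank p j)"
      using that by (simp add: mult_index_rank[OF G(1) Fc fin(2) fin(2) fin(2)] u_def v_def)
    also have "\<dots> = (if i = j then 1 else 0)"
      using that rl by (simp add: G(3) rank_eq_iff[OF fin(2)])
    finally show ?thesis .
  qed
  have vMv: "(\<Sum>k\<in>p. \<Sum>l\<in>p. v i k * M $$ (k, l) * v j l) = (if i = j then 1 else 0)"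
    if "i \<in> p" "j \<in> p" for i j
  proof -
    have "(\<Sum>k\<in>p. \<Sum>l\<in>p. v i k * M $$ (k, l) * v j l) = (\<Sum>k\<in>p. v i k * (\<Sum>l\<in>p. M $$ (k, l) * v j l))"
      by (simp add: sum_distrib_left mult.assoc)
    also have "\<dots> = (G * (submatrix M p p * G\<^sup>T)) $$ (rank p i, rank p j)"
      using that G(1) Mp pN fin rl by (simp add: mult_index_rank[of _ p p _ p] idx v_def del: index_mult_mat(1))
    also have "\<dots> = (if i = j then 1 else 0)"
      using that rl by (simp add: GMG rank_eq_iff[OF fin(2)])
    finally show ?thesis .
  qed
  \<comment> \<open>The cases follow the overwrites from the last to the first; as \<open>n\<close>
    and \<open>p\<close> are disjoint, the three blocks do not overlap.\<close>
  have index: "M' $$ (i, j) = (if i \<in> n \<and> j \<in> p then (submatrix M n p * G\<^sup>T) $$ (rank n i, rank p j)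
      else if i \<in> p \<and> j \<in> n then (G * submatrix M p n) $$ (rank p i, rank n j)
      else if i \<in> p \<and> j \<in> p then 1\<^sub>m (card p) $$ (rank p i, rank p j) else M $$ (i, j))"
    if "i \<in> R" "j \<in> R" for i j
  proof -
    have "i < N" "j < N" using that R by auto
    then show ?thesis unfolding M' G_def by (simp add: set_block_index[where N = N] M)
  qed
  have pp: "M' $$ (i, j) = (if i = j then 1 else 0)" if "i \<in> p" "j \<in> p" for i j
  proof -
    have "i \<in> R" "j \<in> R" "i \<notin> n" "j \<notin> n" using that p nR by auto
    then show ?thesis using that rl by (simp add: index rank_eq_iff[OF fin(2)])
  qed
  have pr: "M' $$ (i, j) = (\<Sum>k\<in>p. v i k * M $$ (k, j)) \<and> M' $$ (j, i) = M' $$ (i, j)"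
    if ij: "i \<in> p" "j \<in> R - p" for i j
  proof (cases "j \<in> n")
    case True
    have "M' $$ (i, j) = (\<Sum>k\<in>p. v i k * M $$ (k, j))"
      using True ij p nR pN nN
      by (simp add: index subset_iff mult_index_rank[OF G(1) Mpn fin(2) fin(3) fin(2)] idx v_def)
    moreover have "M' $$ (j, i) = (\<Sum>k\<in>p. M $$ (j, k) * v i k)"
      using True ij p nR pN nN G(1) Mnp fin rl
      by (simp add: index subset_iff mult_index_rank[of _ n p _ p] idx v_def del: index_mult_mat(1))
    moreover have "M $$ (j, k) = M $$ (k, j)" if "k \<in> p" for k
      using posdef_on_sym[OF pd, of j k] that ij p by auto
    ultimately show ?thesis by (simp add: mult.commute)
  next
    case False
    have "i \<in> R" "i \<notin> n" using ij p nR by auto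
    then show ?thesis using False ij not_coupledD[of j R p M] n by (simp add: index)
  qed
  show rr: "M' $$ (i, j) = M $$ (i, j)" if "i \<in> R - p" "j \<in> R - p" for i j
    using that by (simp add: index)
  have pR: "p \<union> (R - p) = R" using p by auto
  have "posdef_block M' (p \<union> (R - p))"
  proof (rule posdef_on_congruence[where s = p and v = v and u = u])
    show "posdef_block M (p \<union> (R - p))" using pd pR by simp
  qed (use fin pp pr rr vu vMv in auto)
  then show "posdef_block M' R" by (simp only: pR)
  show "one_block M' p" using pp by (simp add: one_block_def)
qed

text \<open>On \<open>R - f\<close> the new matrix is the congruence of the old one by
  \<open>Qc\<^sup>T\<close> on \<open>p\<close> and the identity on \<open>R - p\<close>.
  Orthonormality gives \<open>Qc\<close> as a right inverse of \<open>Qc\<^sup>T\<close>.\<close>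

lemma sparsify_posdef:
  assumes M: "M \<in> carrier_mat N N" and R: "R \<subseteq> {..<N}" and pd: "posdef_block M R"
    and p: "p \<subseteq> R" and n: "n = coupled M R p" and one: "one_block M p"
    and fc: "f \<union> c = p" "f \<inter> c = {}"
    and Qf: "Qf \<in> carrier_mat (card p) (card f)" and Qc: "Qc \<in> carrier_mat (card p) (card c)"
    and Q: "orthonormal_mat (Qf\<^sup>T @\<^sub>r Qc\<^sup>T)\<^sup>T"
    and Wf: "Wf \<in> carrier_mat (card f) (card n)" and Wc: "Wc \<in> carrier_mat (card c) (card n)"
    and W: "submatrix M p n = Qf * Wf + Qc * Wc"
    and M': "M' = set_block_sym (set_block_sym (set_block M p p (1\<^sub>m (card p))) f n Wf) c n Wc"
    and M'': "M'' = set_block_sym M' f n (0\<^sub>m (card f) (card n))"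
  shows "posdef_block M'' (R - f)"
    "\<And>i j. i \<in> R - p \<Longrightarrow> j \<in> R - p \<Longrightarrow> M'' $$ (i, j) = M $$ (i, j)"
proof -
  have nR: "n \<subseteq> R - p" using coupled_subset n by simp
  have fin: "finite R" "finite p" "finite n" "finite c"
    using R p nR fc by (auto intro: finite_subset)
  have pN: "p \<subseteq> {..<N}" and nN: "n \<subseteq> {..<N}" using R p nR by auto
  note idx = submatrix_index_rank[OF M]
  note rl = rank_less[OF fin(2)] rank_less[OF fin(3)] rank_less[OF fin(4)]
  note orth = orthonormal_append[OF Qf Qc Q]
  have Mpn: "submatrix M p n \<in> carrier_mat (card p) (card n)" using M pN nN by (rule submatrix_carrier)
  \<comment> \<open>Orthogonality of \<open>Qc\<close> to \<open>Qf\<close> removes the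
    \<open>Wf\<close> term, and orthonormality of \<open>Qc\<close> leaves
    \<open>Wc\<close>.\<close>
  have "Qc\<^sup>T * submatrix M p n = (Qc\<^sup>T * Qf) * Wf + (Qc\<^sup>T * Qc) * Wc"
    unfolding W using Qf Qc Wf Wc
    by (simp add: mult_add_distrib_mat[of _ "card c" "card p" _ "card n"]
        assoc_mult_mat[of _ "card c" "card p"])
  then have QM: "Qc\<^sup>T * submatrix M p n = Wc" using Wf Wc by (simp add: orth)
  define v where "v i k = Qc $$ (rank p k, rank c i)" for i k
  have vv: "(\<Sum>k\<in>p. v i k * v j k) = (if i = j then 1 else 0)" if "i \<in> c" "j \<in> c" for i j
  proof -
    have "(\<Sum>k\<in>p. v i k * v j k) = (Qc\<^sup>T * Qc) $$ (rank c i, rank c j)"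
      using that Qc fin rl by (simp add: mult_index_rank[of _ c p _ c] v_def del: index_mult_mat(1))
    also have "\<dots> = (if i = j then 1 else 0)"
      using that rl by (simp add: orth rank_eq_iff[OF fin(4)])
    finally show ?thesis .
  qed
  \<comment> \<open>Here the identity block left by scaling enters: it collapses the double sum, so
    the new block on \<open>c\<close> is \<open>Qc\<^sup>T * Qc\<close>.\<close>
  have vMv: "(\<Sum>k\<in>p. \<Sum>l\<in>p. v i k * M $$ (k, l) * v j l) = (\<Sum>k\<in>p. v i k * v j k)" for i j
  proof (rule sum.cong[OF refl])
    fix k assume k: "k \<in> p"
    have "(\<Sum>l\<in>p. v i k * M $$ (k, l) * v j l) = (\<Sum>l\<in>p. if k = l then v i k * v j l else 0)"
      using k one by (intro sum.cong refl) (simp add: one_block_def)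
    then show "(\<Sum>l\<in>p. v i k * M $$ (k, l) * v j l) = v i k * v j k" using k fin by simp
  qed
  have cp: "c \<subseteq> p" and c_f: "c \<inter> f = {}" using fc by auto
  \<comment> \<open>The blocks with a row or column in \<open>f\<close>, including the dropped one,
    lie outside this range; only the identity and the \<open>Wc\<close> blocks remain
    visible.\<close>
  have index: "M'' $$ (i, j) = (if i \<in> n \<and> j \<in> c then Wc\<^sup>T $$ (rank n i, rank c j)
      else if i \<in> c \<and> j \<in> n then Wc $$ (rank c i, rank n j)
      else if i \<in> p \<and> j \<in> p then 1\<^sub>m (card p) $$ (rank p i, rank p j) else M $$ (i, j))"
    if "i \<in> R - f" "j \<in> R - f" for i j
  proof -
    have "i < N" "j < N" using that R by auto
    then show ?thesis using that unfolding M'' M' set_block_sym_def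
      by (simp add: set_block_index[where N = N] M)
  qed
  have cc: "M'' $$ (i, j) = (if i = j then 1 else 0)" if "i \<in> c" "j \<in> c" for i j
  proof -
    have "i \<in> R - f" "j \<in> R - f" "i \<notin> n" "j \<notin> n" "i \<in> p" "j \<in> p"
      using that cp c_f p nR by auto
    then show ?thesis using that rl by (simp add: index rank_eq_iff[OF fin(2)])
  qed
  have cr: "M'' $$ (i, j) = (\<Sum>k\<in>p. v i k * M $$ (k, j)) \<and> M'' $$ (j, i) = M'' $$ (i, j)"
    if ij: "i \<in> c" "j \<in> R - p" for i j
  proof -
    have ijR: "i \<in> R - f" "j \<in> R - f" "i \<notin> n" "j \<notin> c" "i \<in> p" using ij cp c_f fc p nR by auto
    show ?thesis
    proof (cases "j \<in> n")
      case True
      have "(\<Sum>k\<in>p. v i k * M $$ (k, j)) = (Qc\<^sup>T * submatrix M p n) $$ (rank c i, rank n j)"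
        using True ij Qc Mpn fin rl pN nN by (simp add: mult_index_rank[of _ c p _ n] idx v_def del: index_mult_mat(1))
      then show ?thesis using True ij ijR Wc rl by (simp add: QM index)
    next
      case False
      then show ?thesis using ij ijR not_coupledD[of j R p M] n by (simp add: index)
    qed
  qed
  show rr: "M'' $$ (i, j) = M $$ (i, j)" if "i \<in> R - p" "j \<in> R - p" for i j
  proof -
    have "i \<in> R - f" "j \<in> R - f" "i \<notin> c" "j \<notin> c" using that fc by auto
    then show ?thesis using that by (simp add: index)
  qed
  have pR: "p \<union> (R - p) = R" "c \<union> (R - p) = R - f" using p fc by auto
  have "posdef_block M'' (c \<union> (R - p))"
  proof (rule posdef_on_congruence[where s = p and v = v and u = "\<lambda>k j. v j k"])
    show "posdef_block M (p \<union> (R - p))" using pd pR by simp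
  qed (use fin cp cc cr rr vv vMv in auto)
  then show "posdef_block M'' (R - f)" by (simp only: pR)
qed

section \<open>The invariant of a run\<close>

fun phase_inv :: "real mat \<Rightarrow> nat set set \<Rightarrow> phase \<Rightarrow> bool" where
  "phase_inv M P (Eliminate Ss) \<longleftrightarrow> True"
| "phase_inv M P (Scale Ps) \<longleftrightarrow> Ps \<subseteq> P \<and> (\<forall>p\<in>P - Ps. one_block M p)"
| "phase_inv M P (Sparsify Ps) \<longleftrightarrow> Ps \<subseteq> P \<and> (\<forall>p\<in>Ps. one_block M p)"

text \<open>Through \<open>phase_inv\<close> the invariant tracks identity blocks: of the clusters
  already done while scaling, and of those still to do while sparsifying. Disjointness keeps them
  safe when another cluster is processed.\<close>

fun spand_inv :: "nat \<Rightarrow> spand_state \<Rightarrow> bool" where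
  "spand_inv N (State l ph R P M) \<longleftrightarrow> M \<in> carrier_mat N N \<and> R \<subseteq> {..<N} \<and> posdef_block M R \<and>
     \<Union>P \<subseteq> R \<and> disjoint P \<and> phase_inv M P ph"

lemma one_block_transfer:
  assumes "one_block M q" "q \<subseteq> R - p" "\<And>i j. i \<in> R - p \<Longrightarrow> j \<in> R - p \<Longrightarrow> M' $$ (i, j) = M $$ (i, j)"
  shows "one_block M' q"
  using assms unfolding one_block_def by (metis subsetD)

lemma cluster_subset_Diff:
  "disjoint P \<Longrightarrow> \<Union>P \<subseteq> R \<Longrightarrow> p \<in> P \<Longrightarrow> q \<in> P \<Longrightarrow> q \<noteq> p \<Longrightarrow> q \<subseteq> R - p"
  by (auto dest: disjointD)

text \<open>Used with \<open>p - s\<close> in an elimination, and with the union of the clusters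
  inside \<open>q\<close> in a merge.\<close>

lemma disjoint_shrink:
  assumes "disjoint P" "\<And>q. q \<in> P \<Longrightarrow> g q \<subseteq> q"
  shows "disjoint (g ` P)"
  using assms by (fastforce simp: disjoint_def)

lemma eliminate_step_inv:
  assumes "eliminate_step st st'" "spand_inv N st"
  shows "spand_inv N st'"
  using assms
proof (induction rule: eliminate_step.induct)
  case (1 t Ss s R n M F l P)
  then have M: "M \<in> carrier_mat N N" and R: "R \<subseteq> {..<N}" and pd: "posdef_block M R"
    and P: "\<Union>P \<subseteq> R" "disjoint P" by auto
  have "s \<subseteq> R" using 1 by simp
  note pd' = eliminate_posdef[OF M R pd this \<open>n = coupled M R s\<close> \<open>cholesky_factor (submatrix M s s) F\<close>]
  have "disjoint ((\<lambda>p. p - s) ` P)" using P by (intro disjoint_shrink) auto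
  then have "disjoint ((\<lambda>p. p - s) ` P - {{}})" by (rule pairwise_subset) auto
  then show ?case using M R P pd' by auto
qed

lemma scale_step_inv:
  assumes "scale_step st st'" "spand_inv N st"
  shows "spand_inv N st'"
  using assms
proof (induction rule: scale_step.induct)
  case (1 p Ps n M R F l P)
  then have M: "M \<in> carrier_mat N N" and R: "R \<subseteq> {..<N}" and pd: "posdef_block M R"
    and P: "\<Union>P \<subseteq> R" "disjoint P" and Ps: "Ps \<subseteq> P" "\<forall>p\<in>P - Ps. one_block M p" by auto
  have p: "p \<in> P" "p \<subseteq> R" using 1 P Ps by auto
  note step = scale_posdef[OF M R pd p(2) \<open>n = coupled M R p\<close> \<open>cholesky_factor (submatrix M p p) F\<close> refl]
  define M' where "M' = set_block (set_block (set_block M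
           p p (1\<^sub>m (card p)))
           p n (minv F * submatrix M p n))
           n p (submatrix M n p * (minv F)\<^sup>T)"
  note step = step[folded M'_def]
  have "M' \<in> carrier_mat N N" using M by (simp add: M'_def)
  \<comment> \<open>The cluster \<open>p\<close> has just received its identity block; any other
    finished cluster lies in \<open>R - p\<close> and keeps its own.\<close>
  moreover have "one_block M' q" if q: "q \<in> P - (Ps - {p})" for q
  proof (cases "q = p")
    case False
    have "one_block M q" using q False Ps(2) by auto
    moreover have "q \<subseteq> R - p" using q False p(1) by (intro cluster_subset_Diff[OF P(2,1)]) auto
    ultimately show ?thesis using step(3) by (rule one_block_transfer)
  qed (use step in simp)
  ultimately show ?case using R P Ps step(1) unfolding M'_def[symmetric] by auto
qed

lemma sparsify_step_inv:
  assumes "sparsify_step d st st'" "spand_inv N st"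
  shows "spand_inv N st'"
  using assms
proof (induction rule: sparsify_step.induct)
  case (1 p Ps n M R f c Qf Qc Wf Wc M' M'' l P)
  then have M: "M \<in> carrier_mat N N" and R: "R \<subseteq> {..<N}" and pd: "posdef_block M R"
    and P: "\<Union>P \<subseteq> R" "disjoint P" and Ps: "Ps \<subseteq> P" "\<forall>p\<in>Ps. one_block M p" by auto
  have p: "p \<in> P" "p \<subseteq> R" and one: "one_block M p" using 1 P Ps by auto
  note step = sparsify_posdef[OF M R pd p(2) 1(2) one 1(3-10) 1(12,13)]
  have fc: "f \<subseteq> p" "c \<subseteq> p" "f \<inter> c = {}" using 1 by auto
  have M'': "M'' \<in> carrier_mat N N" using M unfolding 1(12,13) set_block_sym_def by simp
  \<comment> \<open>The step leaves the entries on \<open>R - p\<close> alone, so the clusters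
    waiting there still have identity blocks when their turn comes.\<close>
  have other: "q \<subseteq> R - p" if "q \<in> P - {p}" for q
    using that cluster_subset_Diff[OF P(2,1) p(1)] by blast
  have ones: "one_block M'' q" if q: "q \<in> Ps - {p}" for q
  proof -
    have "one_block M q" "q \<subseteq> R - p" using q Ps other by auto
    then show ?thesis using step(2) by (rule one_block_transfer)
  qed
  have union: "\<Union>(P - {p}) \<subseteq> R - p" using other by (rule Union_least)
  have "disjoint ((P - {p}) \<union> ({c} - {{}}))"
  proof (rule disjoint_union)
    show "disjoint (P - {p})" using P(2) by (rule pairwise_subset) blast
    show "\<Union>(P - {p}) \<inter> \<Union>({c} - {{}}) = {}" using union fc by blast
  qed (simp add: disjoint_def)
  moreover have "\<Union>((P - {p}) \<union> ({c} - {{}})) \<subseteq> R - f" using union fc p by blast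
  moreover have "R - f \<subseteq> {..<N}" using R by blast
  moreover have "Ps - {p} \<subseteq> (P - {p}) \<union> ({c} - {{}})" using Ps by blast
  ultimately show ?case using M'' step(1) ones by simp
qed

text \<open>The clusters are the fibres of the labelling.\<close>

lemma disjoint_clusters_at: "disjoint (clusters_at vsep N l)"
  by (auto simp: disjoint_def clusters_at_def)

lemma disjoint_merge:
  assumes "disjoint Qs"
  shows "disjoint (merge Qs P)"
proof -
  have "disjoint ((\<lambda>q. \<Union>{p \<in> P. p \<subseteq> q}) ` Qs)"
    using assms by (rule disjoint_shrink) auto
  then show ?thesis unfolding merge_def by (rule pairwise_subset) auto
qed

text \<open>The condition for \<open>Scale P\<close> is vacuous at the start, and for
  \<open>Scale {}\<close> it covers every cluster, which is what \<open>Sparsify P\<close> requires.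
  Merging keeps the clusters disjoint and inside \<open>R\<close>.\<close>

lemma next_phase_inv:
  assumes "next_phase vsep N L st st'" "spand_inv N st"
  shows "spand_inv N st'"
  using assms
proof (induction rule: next_phase.induct)
  case (3 l R P M)
  moreover have "\<Union>(merge (clusters_at vsep N (l - 1)) P) \<subseteq> \<Union>P" by (auto simp: merge_def)
  ultimately show ?case by (simp add: disjoint_merge disjoint_clusters_at subset_trans)
qed auto

lemma spand_reachable_inv:
  assumes "spand_reachable vsep N L A d st" "A \<in> carrier_mat N N" "spd A"
  shows "spand_inv N st"
  using assms
proof (induction rule: spand_reachable.induct)
  case 1
  have "\<Union>(clusters_at vsep N L) \<subseteq> {..<N}" by (auto simp: clusters_at_def)
  with 1 show ?case by (simp add: disjoint_clusters_at spd_iff_posdef_on)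
next
  case (2 st st')
  then show ?case
    using eliminate_step_inv scale_step_inv sparsify_step_inv next_phase_inv by blast
qed

lemma spand_inv_trailing: "spand_inv N st \<Longrightarrow> spd (trailing st)"
  by (cases st) (auto simp: trailing_def intro: spd_submatrix)

text \<open>Each such block is a principal block of the trailing matrix, indexed by
  \<open>t \<inter> R\<close> or by a cluster, hence by a subset of \<open>R\<close>.\<close>

lemma spand_inv_cholesky_blocks:
  assumes "spand_inv N st" "D \<in> cholesky_blocks st"
  shows "spd D"
proof -
  obtain l ph R P M where st: "st = State l ph R P M" by (cases st)
  with assms have M: "M \<in> carrier_mat N N" and R: "R \<subseteq> {..<N}" and pd: "posdef_block M R" by auto
  obtain I where I: "I \<subseteq> R" "D = submatrix M I I"
  proof (cases ph)
    case (Eliminate Ss)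
    then show ?thesis using assms that unfolding st by auto
  next
    case (Scale Ps)
    then obtain p where "p \<in> Ps" "D = submatrix M p p" using assms unfolding st by auto
    then show ?thesis using Scale assms that[of p] unfolding st by auto
  qed (use assms st in simp)
  have "posdef_block M I"
    using pd I(1) finite_subset[OF R finite_lessThan] by (rule posdef_on_subset)
  with M R I show ?thesis by (auto intro!: spd_submatrix)
qed

theorem corollary3p2:
  fixes A :: "real mat" and N L :: nat and vsep :: separator_routine and \<epsilon> K :: real
  assumes "A \<in> carrier_mat N N" and "spd A"
    and "0 \<le> \<epsilon>"
    and "1 \<le> L"
    and "vertex_separator A vsep"
  shows "(\<forall>st st'. spand_reachable vsep N L A (K * \<epsilon>) st \<and> sparsify_step (K * \<epsilon>) st st' \<longrightarrow>
            spd (trailing st')) \<and>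
         (\<forall>st. spand_reachable vsep N L A (K * \<epsilon>) st \<longrightarrow>
            (\<forall>D \<in> cholesky_blocks st. spd D) \<and> \<not> breaks_down st)"
proof -
  have inv: "spand_inv N st" if "spand_reachable vsep N L A (K * \<epsilon>) st" for st
    using that assms(1,2) by (rule spand_reachable_inv)
  have "spd (trailing st')"
    if "spand_reachable vsep N L A (K * \<epsilon>) st" "sparsify_step (K * \<epsilon>) st st'" for st st'
    using sparsify_step_inv[OF that(2) inv[OF that(1)]] by (rule spand_inv_trailing)
  moreover have "(\<forall>D \<in> cholesky_blocks st. spd D) \<and> \<not> breaks_down st"
    if "spand_reachable vsep N L A (K * \<epsilon>) st" for st
    using spand_inv_cholesky_blocks[OF inv[OF that]] spd_imp_cholesky_factor
    unfolding breaks_down_def by blast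
  ultimately show ?thesis by blast
qed

end
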